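(* Let $G=\langle \mathcal G \mid \mathcal R\rangle$ be a group presentation with $\mathcal G$ finite and $\mathcal R$ recursively enumerable. Suppose there is an algorithm which, given a geodesic word $u\in(\mathcal G^{\pm1})^*$ and a generator $x\in\mathcal G^{\pm 1}$, decides whether $\ell(ux)>\ell(u)$ (Problem 2). Then there is an algorithm which, given any word in $(\mathcal G^{\pm 1})^*$, finds a geodesic representative for it (Problem 3).
   Context: Words are elements of $(\mathcal G^{\pm 1})^*$. A geodesic representative of a word $w$ is a word in $(\mathcal G^{\pm 1})^*$ of minimal length among all words representing the same element of $G$ as $w$; $\ell(w)$ denotes the length of a geodesic representative of $w$. A word $u$ is geodesic if its length equals $\ell(u)$. The set $\mathcal R$ of relators is a set of words in $(\mathcal G^{\pm1})^*$; it is recursively enumerable if some algorithm lists its elements. *)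

theory Defs
  imports "HOL-Algebra.Generated_Groups" "HOL-Library.Nat_Bijection"
begin

section \<open>Words and group presentations\<close>

text \<open>The letter \<open>(g, True)\<close> stands for the generator \<open>g\<close> and \<open>(g, False)\<close> for its formal inverse.\<close>

type_synonym 'g letter = "'g \<times> bool"
type_synonym 'g word = "'g letter list"

definition letters :: "'g set \<Rightarrow> 'g letter set" where
  "letters X = X \<times> UNIV"

definition words :: "'g set \<Rightarrow> 'g word set" where
  "words X = lists (letters X)"

definition inv_letter :: "'g letter \<Rightarrow> 'g letter" where
  "inv_letter x = (fst x, \<not> snd x)"

fun reduced :: "'g word \<Rightarrow> bool" where
  "reduced [] = True"
| "reduced [x] = True"
| "reduced (x # y # w) = (y \<noteq> inv_letter x \<and> reduced (y # w))"

fun cons_reduce :: "'g letter \<Rightarrow> 'g word \<Rightarrow> 'g word" where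
  "cons_reduce x [] = [x]"
| "cons_reduce x (y # w) = (if y = inv_letter x then w else x # y # w)"

definition free_reduce :: "'g word \<Rightarrow> 'g word" where
  "free_reduce w = foldr cons_reduce w []"

definition free_group :: "'g set \<Rightarrow> 'g word monoid" where
  "free_group X =
     \<lparr>carrier = {w \<in> words X. reduced w}, mult = (\<lambda>u v. free_reduce (u @ v)), one = []\<rparr>"

definition normal_closure :: "('a, 'b) monoid_scheme \<Rightarrow> 'a set \<Rightarrow> 'a set" where
  "normal_closure F S =
     generate F {g \<otimes>\<^bsub>F\<^esub> s \<otimes>\<^bsub>F\<^esub> inv\<^bsub>F\<^esub> g | g s. g \<in> carrier F \<and> s \<in> S}"

definition relator_subgroup :: "'g set \<Rightarrow> 'g word set \<Rightarrow> 'g word set" where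
  "relator_subgroup X R = normal_closure (free_group X) (free_reduce ` R)"

definition presented_group :: "'g set \<Rightarrow> 'g word set \<Rightarrow> 'g word set monoid" where
  "presented_group X R = free_group X Mod relator_subgroup X R"

text \<open>The element of \<^term>\<open>presented_group X R\<close> represented by a word.\<close>

definition element_of :: "'g set \<Rightarrow> 'g word set \<Rightarrow> 'g word \<Rightarrow> 'g word set" where
  "element_of X R w = relator_subgroup X R #>\<^bsub>free_group X\<^esub> free_reduce w"


subsection \<open>Geodesics\<close>

definition geodesic_rep :: "'g set \<Rightarrow> 'g word set \<Rightarrow> 'g word \<Rightarrow> 'g word \<Rightarrow> bool" where
  "geodesic_rep X R w v \<longleftrightarrow>
     v \<in> words X \<and> element_of X R v = element_of X R w \<and>
     (\<forall>u \<in> words X. element_of X R u = element_of X R w \<longrightarrow> length v \<le> length u)"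

definition geodesic_length :: "'g set \<Rightarrow> 'g word set \<Rightarrow> 'g word \<Rightarrow> nat" where
  "geodesic_length X R w = (THE n. \<exists>v. geodesic_rep X R w v \<and> n = length v)"

definition geodesic :: "'g set \<Rightarrow> 'g word set \<Rightarrow> 'g word \<Rightarrow> bool" where
  "geodesic X R u \<longleftrightarrow> u \<in> words X \<and> length u = geodesic_length X R u"


section \<open>Algorithms: partial recursive functions\<close>

datatype prog = Zero | Succ | Proj nat | Comp prog "prog list" | Prec prog prog | Mu prog

text \<open>\<open>computes p xs y\<close>: the program \<open>p\<close>, run on the argument tuple \<open>xs\<close>, halts with output \<open>y\<close>.\<close>

inductive computes :: "prog \<Rightarrow> nat list \<Rightarrow> nat \<Rightarrow> bool" where
  zero: "computes Zero xs 0"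
| succ: "computes Succ [x] (Suc x)"
| proj: "i < length xs \<Longrightarrow> computes (Proj i) xs (xs ! i)"
| comp: "list_all2 (\<lambda>p y. computes p xs y) ps ys \<Longrightarrow> computes q ys z \<Longrightarrow>
    computes (Comp q ps) xs z"
| prec_0: "computes p xs y \<Longrightarrow> computes (Prec p q) (0 # xs) y"
| prec_Suc: "computes (Prec p q) (n # xs) r \<Longrightarrow> computes q (n # r # xs) y \<Longrightarrow>
    computes (Prec p q) (Suc n # xs) y"
| mu: "computes p (n # xs) 0 \<Longrightarrow> \<forall>m<n. \<exists>k. computes p (m # xs) (Suc k) \<Longrightarrow>
    computes (Mu p) xs n"

definition recursively_enumerable :: "nat set \<Rightarrow> bool" where
  "recursively_enumerable A \<longleftrightarrow>
     A = {} \<or> (\<exists>p. (\<forall>n. \<exists>y. computes p [n] y) \<and> A = {y. \<exists>n. computes p [n] y})"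

text \<open>
  Words over a finite alphabet are handed to programs as numbers, after numbering the letters by
  an injective function \<open>\<nu>\<close>.
\<close>

definition word_code :: "('g letter \<Rightarrow> nat) \<Rightarrow> 'g word \<Rightarrow> nat" where
  "word_code \<nu> w = list_encode (map \<nu> w)"

text \<open>
  The program is only constrained when \<open>u\<close> is geodesic; otherwise it may return anything or
  fail to halt.
\<close>

definition decides_length_increase ::
  "('g letter \<Rightarrow> nat) \<Rightarrow> 'g set \<Rightarrow> 'g word set \<Rightarrow> prog \<Rightarrow> bool" where
  "decides_length_increase \<nu> X R p \<longleftrightarrow>
     (\<forall>u x. geodesic X R u \<longrightarrow> x \<in> letters X \<longrightarrow>
        computes p [word_code \<nu> u, \<nu> x]
          (if geodesic_length X R (u @ [x]) > geodesic_length X R u then 1 else 0))"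

definition finds_geodesic_rep ::
  "('g letter \<Rightarrow> nat) \<Rightarrow> 'g set \<Rightarrow> 'g word set \<Rightarrow> prog \<Rightarrow> bool" where
  "finds_geodesic_rep \<nu> X R p \<longleftrightarrow>
     (\<forall>w \<in> words X. \<exists>v. geodesic_rep X R w v \<and> computes p [word_code \<nu> w] (word_code \<nu> v))"


section \<open>Well-definedness\<close>

text \<open>Programs are deterministic, so each one defines a partial function.\<close>

lemma computes_det: "computes p xs y \<Longrightarrow> computes p xs z \<Longrightarrow> y = z"
proof (induction arbitrary: z rule: computes.induct)
  case (zero xs)
  then show ?case by (auto elim: computes.cases)
next
  case (succ x)
  then show ?case by (auto elim: computes.cases)
next
  case (proj i xs)
  from proj.prems show ?case by cases auto
next
  case (comp xs ps ys q z')
  from comp.prems obtain ys' where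
    ys': "list_all2 (\<lambda>p y. computes p xs y) ps ys'" "computes q ys' z"
    by cases auto
  have "ys = ys'"
    using comp.IH(1) ys'(1) by (auto simp: list_all2_conv_all_nth intro!: nth_equalityI)
  with comp.IH(2) ys'(2) show ?case by simp
next
  case (prec_0 p xs y q)
  from prec_0.prems prec_0.IH show ?case by cases auto
next
  case (prec_Suc p q n xs r y)
  from prec_Suc.prems show ?case
    by cases (use prec_Suc.IH in blast)
next
  case (mu p n xs)
  from mu.prems have z: "computes p (z # xs) 0" "\<forall>m<z. \<exists>k. computes p (m # xs) (Suc k)"
    by (cases; simp)+
  have "\<not> n < z" using mu.IH(1) z(2) by fastforce
  moreover have "\<not> z < n" using mu.IH(2) z(1) by fastforce
  ultimately show ?case by simp
qed

lemma inv_letter_simps [simp]: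
  "inv_letter (inv_letter x) = x" "inv_letter x \<noteq> x"
  "inv_letter x \<in> letters X \<longleftrightarrow> x \<in> letters X"
  by (cases x; auto simp: inv_letter_def letters_def)+

lemma reduced_ConsD: "reduced (x # w) \<Longrightarrow> reduced w"
  by (cases w) auto

lemma reduced_cons_reduce: "reduced w \<Longrightarrow> reduced (cons_reduce x w)"
  by (cases w) (auto dest: reduced_ConsD)

lemma reduced_foldr: "reduced w \<Longrightarrow> reduced (foldr cons_reduce u w)"
  by (induction u) (auto intro: reduced_cons_reduce)

lemma reduced_free_reduce: "reduced (free_reduce w)"
  unfolding free_reduce_def by (intro reduced_foldr) simp

lemma free_reduce_id: "reduced w \<Longrightarrow> free_reduce w = w"
proof (induction w)
  case (Cons x w)
  then have "free_reduce w = w" by (blast dest: reduced_ConsD)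
  with Cons.prems show ?case by (cases w) (auto simp: free_reduce_def)
qed (simp add: free_reduce_def)

lemma cons_reduce_inv: "reduced w \<Longrightarrow> cons_reduce x (cons_reduce (inv_letter x) w) = w"
  by (cases w rule: reduced.cases) auto

lemma foldr_cons_reduce:
  assumes "reduced w"
  shows "foldr cons_reduce (cons_reduce x u) w = cons_reduce x (foldr cons_reduce u w)"
  using assms by (cases u) (auto simp: cons_reduce_inv reduced_foldr)

lemma foldr_free_reduce:
  "reduced w \<Longrightarrow> foldr cons_reduce (free_reduce u) w = foldr cons_reduce u w"
  by (induction u) (auto simp: free_reduce_def foldr_cons_reduce)

lemma free_reduce_append:
  "free_reduce (free_reduce u @ v) = free_reduce (u @ v)"
  "free_reduce (u @ free_reduce v) = free_reduce (u @ v)"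
proof -
  have append: "free_reduce (a @ b) = foldr cons_reduce a (free_reduce b)" for a b :: "'a word"
    by (simp add: free_reduce_def)
  show "free_reduce (free_reduce u @ v) = free_reduce (u @ v)"
    by (simp add: append foldr_free_reduce reduced_free_reduce)
  show "free_reduce (u @ free_reduce v) = free_reduce (u @ v)"
    by (simp add: append free_reduce_id reduced_free_reduce)
qed

lemma free_reduce_words: "w \<in> words X \<Longrightarrow> free_reduce w \<in> words X"
proof (induction w)
  case (Cons x w)
  then have "free_reduce w \<in> words X" "x \<in> letters X" by (auto simp: words_def)
  then show ?case by (cases "free_reduce w") (auto simp: free_reduce_def words_def)
qed (simp add: free_reduce_def words_def)

lemma free_reduce_inverse: "free_reduce (rev (map inv_letter w) @ w) = []"
proof (induction w)
  case (Cons x w)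
  have "cons_reduce (inv_letter x) (cons_reduce x (free_reduce w)) = free_reduce w"
    using cons_reduce_inv[of "free_reduce w" "inv_letter x"] by (simp add: reduced_free_reduce)
  with Cons show ?case by (simp add: free_reduce_def)
qed (simp add: free_reduce_def)

lemma group_free_group: "group (free_group X)"
proof (rule groupI)
  fix u assume "u \<in> carrier (free_group X)"
  then have u: "u \<in> words X" by (simp add: free_group_def)
  define v where "v = free_reduce (rev (map inv_letter u))"
  have "v \<in> carrier (free_group X)"
    using u unfolding v_def free_group_def
    by (auto simp: reduced_free_reduce words_def intro!: free_reduce_words[unfolded words_def])
  moreover have "v \<otimes>\<^bsub>free_group X\<^esub> u = \<one>\<^bsub>free_group X\<^esub>"
    by (simp add: v_def free_group_def free_reduce_append free_reduce_inverse)
  ultimately show "\<exists>v\<in>carrier (free_group X). v \<otimes>\<^bsub>free_group X\<^esub> u = \<one>\<^bsub>free_group X\<^esub>"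
    by blast
next
  fix u v assume "u \<in> carrier (free_group X)" "v \<in> carrier (free_group X)"
  then have "u @ v \<in> words X" by (auto simp: free_group_def words_def)
  then show "u \<otimes>\<^bsub>free_group X\<^esub> v \<in> carrier (free_group X)"
    by (simp add: free_group_def reduced_free_reduce free_reduce_words)
qed (auto simp: free_group_def free_reduce_append free_reduce_id words_def)

lemma (in group) normal_closure_normal:
  assumes "S \<subseteq> carrier G"
  shows "normal_closure G S \<lhd> G"
  unfolding normal_closure_def
proof (rule normal_generateI)
  fix h k assume "h \<in> {g \<otimes> s \<otimes> inv g | g s. g \<in> carrier G \<and> s \<in> S}" and k: "k \<in> carrier G"
  then obtain g s where h: "h = g \<otimes> s \<otimes> inv g" "g \<in> carrier G" "s \<in> S" by blast
  then have "k \<otimes> h \<otimes> inv k = (k \<otimes> g) \<otimes> s \<otimes> inv (k \<otimes> g)"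
    using assms k by (auto simp: m_assoc inv_mult_group subset_iff)
  with h k show "k \<otimes> h \<otimes> inv k \<in> {g \<otimes> s \<otimes> inv g | g s. g \<in> carrier G \<and> s \<in> S}"
    by blast
qed (use assms in auto)

lemma relator_subgroup_normal:
  assumes "R \<subseteq> words X"
  shows "relator_subgroup X R \<lhd> free_group X"
  unfolding relator_subgroup_def
  by (rule group.normal_closure_normal[OF group_free_group])
    (use assms in \<open>auto simp: free_group_def reduced_free_reduce free_reduce_words\<close>)

lemma group_presented_group: "R \<subseteq> words X \<Longrightarrow> group (presented_group X R)"
  unfolding presented_group_def
  by (intro normal.factorgroup_is_group relator_subgroup_normal)

lemma element_of_in_carrier:
  assumes "w \<in> words X"
  shows "element_of X R w \<in> carrier (presented_group X R)"
proof -
  have "free_reduce w \<in> carrier (free_group X)"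
    using assms by (simp add: free_group_def reduced_free_reduce free_reduce_words)
  then show ?thesis
    by (auto simp: element_of_def presented_group_def FactGroup_def RCOSETS_def)
qed

lemma element_of_append:
  assumes R: "R \<subseteq> words X" and uv: "u \<in> words X" "v \<in> words X"
  shows "element_of X R (u @ v) =
    element_of X R u \<otimes>\<^bsub>presented_group X R\<^esub> element_of X R v"
proof -
  interpret N: normal "relator_subgroup X R" "free_group X"
    using R by (rule relator_subgroup_normal)
  have c: "free_reduce u \<in> carrier (free_group X)" "free_reduce v \<in> carrier (free_group X)"
    using uv by (auto simp: free_group_def reduced_free_reduce free_reduce_words)
  have "free_reduce u \<otimes>\<^bsub>free_group X\<^esub> free_reduce v = free_reduce (u @ v)"
    by (simp add: free_group_def free_reduce_append)
  with N.rcos_sum[OF c] show ?thesis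
    by (simp add: element_of_def presented_group_def FactGroup_def)
qed

lemma ex_geodesic_rep:
  assumes "w \<in> words X"
  shows "\<exists>v. geodesic_rep X R w v"
  using ex_has_least_nat[of "\<lambda>v. v \<in> words X \<and> element_of X R v = element_of X R w" w length] assms
  unfolding geodesic_rep_def by blast

lemma geodesic_length_eq:
  assumes "geodesic_rep X R w v"
  shows "geodesic_length X R w = length v"
  unfolding geodesic_length_def
  using assms by (intro the_equality) (auto simp: geodesic_rep_def intro: le_antisym)

end

theory Submission
  imports Defs
begin

text \<open>
  A word is geodesic iff appending its letters one by one increases the length at every step, so
  the given decision procedure recognizes geodesics. The words that represent the same element
  as \<open>w\<close> are those reachable from \<open>w\<close> by inserting and deleting relators and words \<open>x x\<^sup>-\<^sup>1\<close>, hence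
  they can be enumerated, and the search for a geodesic one among them always succeeds.

  The decision procedure may diverge on words that are not geodesic. The test therefore runs
  greedily: a letter is appended only if the result is still geodesic, and a word is geodesic iff
  the greedy run returns it unchanged.
\<close>

section \<open>Programs for list operations\<close>

lemma computes_Proj:
  "computes (Proj 0) (a # xs) a"
  "computes (Proj 1) (a # b # xs) b"
  "computes (Proj 2) (a # b # c # xs) c"
  using proj[of 0 "a # xs"] proj[of 1 "a # b # xs"] proj[of 2 "a # b # c # xs"] by simp_all

lemma computes_Comp:
  "computes p xs a \<Longrightarrow> computes q [a] z \<Longrightarrow> computes (Comp q [p]) xs z"
  "computes p xs a \<Longrightarrow> computes p' xs b \<Longrightarrow> computes q [a, b] z \<Longrightarrow>
    computes (Comp q [p, p']) xs z"
  "computes p xs a \<Longrightarrow> computes p' xs b \<Longrightarrow> computes p'' xs c \<Longrightarrow> computes q [a, b, c] z \<Longrightarrow>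
    computes (Comp q [p, p', p'']) xs z"
  by (rule comp[rotated], assumption, simp)+

text \<open>Here \<open>f i\<close> is the value after \<open>i\<close> rounds of the recursion.
  Later uses only have to verify the base and a single round.\<close>

lemma computes_Prec:
  assumes "computes p xs (f 0)"
    and "\<And>i. i < n \<Longrightarrow> computes q (i # f i # xs) (f (Suc i))"
  shows "computes (Prec p q) (n # xs) (f n)"
  using assms by (induction n) (auto intro: prec_0 prec_Suc)

text \<open>Totality of \<open>p\<close> supplies the halting successor values below the least zero
  that the rule \<open>mu\<close> demands.\<close>

lemma computes_Mu:
  assumes "\<And>n. computes p (n # xs) (f n)" and "f m = 0"
  shows "computes (Mu p) xs (LEAST n. f n = 0)"
proof (rule mu)
  show "computes p ((LEAST n. f n = 0) # xs) 0"
    using assms(1)[of "LEAST n. f n = 0"] LeastI[of "\<lambda>n. f n = 0", OF assms(2)] by simp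
  show "\<forall>m<LEAST n. f n = 0. \<exists>k. computes p (m # xs) (Suc k)"
    using assms(1) not_less_Least[of _ "\<lambda>n. f n = 0"] by (metis not0_implies_Suc)
qed

lemmas computes_rules = computes_Proj computes_Comp zero succ

lemma ex_computes_const: "\<exists>p. \<forall>xs. computes p xs n"
proof (induction n)
  case (Suc n)
  then show ?case by (blast intro: computes_rules)
qed (blast intro: zero)

section \<open>Conditionals and truncated arithmetic\<close>

definition "if_prog = Prec (Proj 1) (Proj 2)"
definition "pred_prog = Prec Zero (Proj 0)"
definition "add_prog = Prec (Proj 0) (Comp Succ [Proj 1])"
text \<open>\<open>Prec\<close> recurses on the first argument, so iterating the predecessor gives
  subtraction with its arguments swapped.\<close>

definition "rsub_prog = Prec (Proj 0) (Comp pred_prog [Proj 1])"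
definition "sub_prog = Comp rsub_prog [Proj 1, Proj 0]"
text \<open>The sum of both truncated differences is the distance. It vanishes exactly on equality,
  which suits \<open>if_prog\<close> and \<open>Mu\<close>.\<close>

definition "neq_prog = Comp add_prog [sub_prog, rsub_prog]"

text \<open>The base case of the recursion returns \<open>b\<close> and every further round returns
  \<open>a\<close>. Since \<open>Comp\<close> evaluates all its arguments first, both branches have
  to halt wherever this is applied.\<close>

lemma computes_if: "computes if_prog [c, a, b] (if c = 0 then b else a)"
  unfolding if_prog_def
  by (rule computes_Prec[where f = "\<lambda>n. if n = 0 then b else a"])
    (auto intro: computes_rules simp del: One_nat_def)

lemma computes_pred: "computes pred_prog [n] (n - 1)"
  unfolding pred_prog_def
  by (rule computes_Prec[where f = "\<lambda>n. n - 1"]) (auto intro: computes_rules)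

lemma computes_add: "computes add_prog [m, n] (m + n)"
  unfolding add_prog_def
  by (rule computes_Prec[where f = "\<lambda>m. m + n"])
    (auto intro: computes_rules simp del: One_nat_def)

lemma computes_rsub: "computes rsub_prog [m, n] (n - m)"
  unfolding rsub_prog_def
proof (rule computes_Prec[where f = "\<lambda>m. n - m"])
  fix i
  have "computes pred_prog [n - i] (n - Suc i)"
    using computes_pred[of "n - i"] by simp
  then show "computes (Comp pred_prog [Proj 1]) [i, n - i, n] (n - Suc i)"
    by (rule computes_Comp(1)[OF computes_Proj(2)])
qed (auto intro: computes_rules)

lemma computes_sub: "computes sub_prog [m, n] (m - n)"
  unfolding sub_prog_def by (rule computes_rules computes_rsub)+

lemma computes_neq: "computes neq_prog [m, n] ((m - n) + (n - m))"
  unfolding neq_prog_def by (rule computes_rules computes_rsub computes_sub computes_add)+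

section \<open>The Cantor pairing function and its projections\<close>

definition "triangle_prog = Prec Zero (Comp add_prog [Proj 1, Comp Succ [Proj 0]])"
definition "pair_prog = Comp add_prog [Comp triangle_prog [add_prog], Proj 0]"
definition "diag_prog =
  Mu (Comp sub_prog [Comp Succ [Proj 1], Comp triangle_prog [Comp Succ [Proj 0]]])"
definition "fst_prog = Comp sub_prog [Proj 0, Comp triangle_prog [diag_prog]]"
definition "snd_prog = Comp sub_prog [diag_prog, fst_prog]"

lemma computes_triangle: "computes triangle_prog [n] (triangle n)"
  unfolding triangle_prog_def
proof (rule computes_Prec[where f = triangle])
  show "computes (Comp add_prog [Proj 1, Comp Succ [Proj 0]]) [i, triangle i] (triangle (Suc i))"
    for i unfolding triangle_Suc by (rule computes_rules computes_add)+
qed (auto intro: zero)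

lemma computes_pair: "computes pair_prog [m, n] (prod_encode (m, n))"
  unfolding pair_prog_def prod_encode_def prod.case
  by (rule computes_rules computes_add computes_triangle)+

lemma triangle_mono: "m \<le> n \<Longrightarrow> triangle m \<le> triangle n"
  by (rule lift_Suc_mono_le[of triangle]) auto

text \<open>The diagonal of a pair is found as the least \<open>s\<close> whose successor has a triangle number
  exceeding the code.\<close>

lemma computes_diag: "computes diag_prog [prod_encode (a, b)] (a + b)"
proof -
  let ?f = "\<lambda>s. Suc (prod_encode (a, b)) - triangle (Suc s)"
  have "(LEAST s. ?f s = 0) = a + b"
  proof (rule Least_equality)
    show "?f (a + b) = 0" by (simp add: prod_encode_def)
    show "a + b \<le> s" if "?f s = 0" for s
    proof (rule ccontr)
      assume "\<not> a + b \<le> s"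
      then have "triangle (Suc s) \<le> triangle (a + b)" by (intro triangle_mono) simp
      with that show False by (simp add: prod_encode_def)
    qed
  qed
  moreover have "computes diag_prog [prod_encode (a, b)] (LEAST s. ?f s = 0)"
    unfolding diag_prog_def
  proof (rule computes_Mu)
    show "computes (Comp sub_prog [Comp Succ [Proj 1], Comp triangle_prog [Comp Succ [Proj 0]]])
      [s, prod_encode (a, b)] (?f s)" for s
      by (rule computes_rules computes_sub computes_triangle)+
    show "?f (a + b) = 0" by (simp add: prod_encode_def)
  qed
  ultimately show ?thesis by simp
qed

text \<open>The code of \<open>(a, b)\<close> is \<open>triangle (a + b) + a\<close>, and the
  diagonal \<open>a + b\<close> is already computable.\<close>

lemma computes_fst: "computes fst_prog [n] (fst (prod_decode n))"
proof -
  obtain a b where n: "n = prod_encode (a, b)"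
    by (metis prod_decode_inverse surj_pair)
  have "computes fst_prog [n] (prod_encode (a, b) - triangle (a + b))"
    unfolding fst_prog_def n
    by (rule computes_rules computes_sub computes_triangle computes_diag)+
  \<comment> \<open>The first \<open>simp\<close> cancels \<open>prod_decode\<close> against
    \<open>prod_encode\<close>; only then may \<open>prod_encode\<close> be unfolded.\<close>
  then show ?thesis by (simp add: n) (simp add: prod_encode_def)
qed

lemma computes_snd: "computes snd_prog [n] (snd (prod_decode n))"
proof -
  obtain a b where n: "n = prod_encode (a, b)"
    by (metis prod_decode_inverse surj_pair)
  have "computes snd_prog [n] ((a + b) - fst (prod_decode (prod_encode (a, b))))"
    unfolding snd_prog_def n
    by (rule computes_rules computes_sub computes_diag computes_fst)+
  then show ?thesis by (simp add: n)
qed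

section \<open>Lists coded by iterated pairing\<close>

definition "cons_prog = Comp Succ [pair_prog]"
definition "hd_prog = Comp fst_prog [pred_prog]"
definition "tl_prog = Comp snd_prog [pred_prog]"
definition "drop_prog = Prec (Proj 0) (Comp tl_prog [Proj 1])"
text \<open>The empty list has code 0, so the least number of tails that reaches 0 is the
  length.\<close>

definition "length_prog = Mu drop_prog"

lemma computes_cons: "computes cons_prog [x, list_encode xs] (list_encode (x # xs))"
  unfolding cons_prog_def list_encode.simps by (rule computes_rules computes_pair)+

lemma computes_hd: "computes hd_prog [list_encode (x # xs)] x"
proof -
  have "computes hd_prog [list_encode (x # xs)] (fst (prod_decode (list_encode (x # xs) - 1)))"
    unfolding hd_prog_def by (rule computes_rules computes_pred computes_fst)+
  then show ?thesis by simp
qed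

lemma computes_tl: "computes tl_prog [list_encode xs] (list_encode (tl xs))"
proof -
  have "computes tl_prog [list_encode xs] (snd (prod_decode (list_encode xs - 1)))"
    unfolding tl_prog_def by (rule computes_rules computes_pred computes_snd)+
  \<comment> \<open>For the empty list the predecessor of 0 is again 0, which decodes to a pair with
    second component 0, the code of \<open>tl []\<close>.\<close>
  moreover have "prod_decode 0 = (0, 0)"
    using prod_encode_inverse[of "(0, 0)"] by (simp add: prod_encode_def)
  ultimately show ?thesis by (cases xs) simp_all
qed

lemma computes_drop: "computes drop_prog [n, list_encode xs] (list_encode (drop n xs))"
  unfolding drop_prog_def
proof (rule computes_Prec[where f = "\<lambda>n. list_encode (drop n xs)"])
  show "computes (Comp tl_prog [Proj 1]) [i, list_encode (drop i xs), list_encode xs]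
    (list_encode (drop (Suc i) xs))" for i
    unfolding drop_Suc tl_drop[symmetric] by (rule computes_rules computes_tl)+
qed (simp, rule computes_rules)

lemma computes_length: "computes length_prog [list_encode xs] (length xs)"
  unfolding length_prog_def
proof (rule mu)
  show "computes drop_prog [length xs, list_encode xs] 0"
    using computes_drop[of "length xs" xs] by simp
  show "\<forall>m<length xs. \<exists>k. computes drop_prog [m, list_encode xs] (Suc k)"
    using computes_drop[of _ xs] by (metis Cons_nth_drop_Suc list_encode.simps(2))
qed

definition "fold_prog p =
  Comp (Prec (Proj 1) (Comp p [Comp hd_prog [Comp drop_prog [Proj 0, Proj 2]], Proj 1]))
    [Comp length_prog [Proj 0], Proj 0, Proj 1]"

text \<open>The loop counter \<open>i\<close> fetches the letter as the head of
  \<open>drop i xs\<close>. The hypothesis constrains \<open>p\<close> only on accumulators that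
  occur in the run, so \<open>p\<close> may diverge elsewhere.\<close>

lemma computes_fold:
  assumes "\<And>i. i < length xs \<Longrightarrow> computes p [xs ! i, f i] (f (Suc i))"
  shows "computes (fold_prog p) [list_encode xs, f 0] (f (length xs))"
  unfolding fold_prog_def
proof (rule computes_Comp(3))
  show "computes (Comp length_prog [Proj 0]) [list_encode xs, f 0] (length xs)"
    by (rule computes_rules computes_length)+
  show "computes (Prec (Proj 1) (Comp p [Comp hd_prog [Comp drop_prog [Proj 0, Proj 2]], Proj 1]))
    [length xs, list_encode xs, f 0] (f (length xs))"
  proof (rule computes_Prec[where f = f])
    fix i assume i: "i < length xs"
    have "computes (Comp hd_prog [Comp drop_prog [Proj 0, Proj 2]])
      [i, f i, list_encode xs, f 0] (xs ! i)"
    proof (rule computes_Comp(1))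
      show "computes (Comp drop_prog [Proj 0, Proj 2])
        [i, f i, list_encode xs, f 0] (list_encode (xs ! i # drop (Suc i) xs))"
        unfolding Cons_nth_drop_Suc[OF i] by (rule computes_rules computes_drop)+
    qed (rule computes_hd)
    then show "computes (Comp p [Comp hd_prog [Comp drop_prog [Proj 0, Proj 2]], Proj 1])
        [i, f i, list_encode xs, f 0] (f (Suc i))"
      by (rule computes_Comp) (rule computes_rules assms[OF i])+
  qed (rule computes_rules)
qed (rule computes_rules)+

text \<open>Folding with cons reverses the list that is consumed, so \<open>append_prog\<close>
  reverses its first argument beforehand.\<close>

definition "rev_append_prog = fold_prog cons_prog"
definition "append_prog = Comp rev_append_prog [Comp rev_append_prog [Proj 0, Zero], Proj 1]"

lemma computes_rev_append:
  "computes rev_append_prog [list_encode xs, list_encode ys] (list_encode (rev xs @ ys))"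
proof -
  let ?f = "\<lambda>i. list_encode (rev (take i xs) @ ys)"
  have "computes (fold_prog cons_prog) [list_encode xs, ?f 0] (?f (length xs))"
  proof (rule computes_fold)
    fix i assume "i < length xs"
    then show "computes cons_prog [xs ! i, ?f i] (?f (Suc i))"
      using computes_cons[of "xs ! i" "rev (take i xs) @ ys"]
      by (simp only: take_Suc_conv_app_nth rev_append rev.simps append.simps)
  qed
  then show ?thesis by (simp add: rev_append_prog_def)
qed

lemma computes_append:
  "computes append_prog [list_encode xs, list_encode ys] (list_encode (xs @ ys))"
proof -
  have "computes (Comp rev_append_prog [Proj 0, Zero]) [list_encode xs, list_encode ys]
    (list_encode (rev xs))"
    using computes_rev_append[of xs "[]"] by (auto intro: computes_rules)
  moreover have "computes rev_append_prog [list_encode (rev xs), list_encode ys]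
    (list_encode (xs @ ys))"
    using computes_rev_append[of "rev xs" ys] by simp
  ultimately show ?thesis
    unfolding append_prog_def by (blast intro: computes_rules)
qed

text \<open>The code \<open>i\<close> lists the position, as a splitting \<open>a @ b\<close> of the result of deleting the
  word, and the index of the word that is to be inserted or deleted.\<close>

definition rewrite_at :: "(nat \<Rightarrow> nat list) \<Rightarrow> nat \<Rightarrow> nat list \<Rightarrow> nat list" where
  "rewrite_at r i u =
    (let a = list_decode (fst (prod_decode i));
         s = r (fst (prod_decode (snd (prod_decode i))));
         b = list_decode (snd (prod_decode (snd (prod_decode i))))
     in if u = a @ b then a @ s @ b else if u = a @ s @ b then a @ b else u)"

definition "rewrite_prog p =
  (let a = Comp fst_prog [Proj 0];
       s = Comp p [Comp fst_prog [Comp snd_prog [Proj 0]]];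
       b = Comp snd_prog [Comp snd_prog [Proj 0]];
       ab = Comp append_prog [a, b];
       asb = Comp append_prog [a, Comp append_prog [s, b]]
   in Comp if_prog [Comp neq_prog [Proj 1, ab],
        Comp if_prog [Comp neq_prog [Proj 1, asb], Proj 1, ab], asb])"

lemma computes_rewrite:
  assumes "\<And>n. computes p [n] (list_encode (r n))"
  shows "computes (rewrite_prog p) [i, list_encode u] (list_encode (rewrite_at r i u))"
proof -
  define a where "a = list_decode (fst (prod_decode i))"
  define k where "k = fst (prod_decode (snd (prod_decode i)))"
  define b where "b = list_decode (snd (prod_decode (snd (prod_decode i))))"
  let ?xs = "[i, list_encode u]"
  have a: "computes (Comp fst_prog [Proj 0]) ?xs (list_encode a)"
    unfolding a_def list_decode_inverse by (rule computes_rules computes_fst)+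
  have s: "computes (Comp p [Comp fst_prog [Comp snd_prog [Proj 0]]]) ?xs (list_encode (r k))"
    unfolding k_def by (rule computes_rules computes_fst computes_snd assms)+
  have b: "computes (Comp snd_prog [Comp snd_prog [Proj 0]]) ?xs (list_encode b)"
    unfolding b_def list_decode_inverse by (rule computes_rules computes_snd)+
  let ?d = "\<lambda>m n::nat. (m - n) + (n - m)"
  have "computes (rewrite_prog p) ?xs
    (if ?d (list_encode u) (list_encode (a @ b)) = 0 then list_encode (a @ r k @ b)
     else if ?d (list_encode u) (list_encode (a @ r k @ b)) = 0 then list_encode (a @ b)
     else list_encode u)"
    unfolding rewrite_prog_def Let_def
    by (rule a s b computes_append computes_neq computes_if computes_rules)+
  moreover have "?d (list_encode x) (list_encode y) = 0 \<longleftrightarrow> x = y" for x y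
    using list_encode_eq[of x y] by linarith
  moreover have "rewrite_at r i u =
    (if u = a @ b then a @ r k @ b else if u = a @ r k @ b then a @ b else u)"
    by (simp add: rewrite_at_def Let_def a_def b_def k_def)
  ultimately show ?thesis by (simp only: if_distrib[of list_encode])
qed

text \<open>Every number decodes to a list of instructions, and \<open>rewrite_at\<close> ignores
  one that does not fit. Hence an unbounded search over \<open>c\<close> covers all finite
  derivations.\<close>

definition rewrite_seq :: "(nat \<Rightarrow> nat list) \<Rightarrow> nat \<Rightarrow> nat list \<Rightarrow> nat list" where
  "rewrite_seq r c u = foldl (\<lambda>u i. rewrite_at r i u) u (list_decode c)"

lemma computes_rewrite_seq:
  assumes "\<And>n. computes p [n] (list_encode (r n))"
  shows "computes (fold_prog (rewrite_prog p)) [c, list_encode u] (list_encode (rewrite_seq r c u))"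
proof -
  let ?is = "list_decode c"
  let ?f = "\<lambda>j. list_encode (foldl (\<lambda>u i. rewrite_at r i u) u (take j ?is))"
  have "computes (fold_prog (rewrite_prog p)) [list_encode ?is, ?f 0] (?f (length ?is))"
    by (rule computes_fold)
      (use computes_rewrite[of p r, OF assms] in \<open>simp add: take_Suc_conv_app_nth\<close>)
  then show ?thesis by (simp add: rewrite_seq_def)
qed

text \<open>An enumeration of \<open>A\<close> is shifted by one and \<open>a\<close> is output at
  0. If \<open>A\<close> is empty, a constant program enumerates the singleton.\<close>

lemma recursively_enumerable_insert:
  assumes "recursively_enumerable A"
  shows "recursively_enumerable (insert a A)"
proof -
  obtain pa where pa: "\<And>xs. computes pa xs a" using ex_computes_const by blast
  show ?thesis
  proof (cases "A = {}")
    case True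
    with pa show ?thesis
      unfolding recursively_enumerable_def by (auto intro!: exI[of _ pa] dest: computes_det)
  next
    case False
    with assms obtain p where p: "\<forall>n. \<exists>y. computes p [n] y" "A = {y. \<exists>n. computes p [n] y}"
      unfolding recursively_enumerable_def by blast
    from p(1) obtain f where f: "\<And>n. computes p [n] (f n)" by metis
    have A: "A = range f" unfolding p(2) using f by (auto dest: computes_det)
    let ?g = "\<lambda>n. case n of 0 \<Rightarrow> a | Suc m \<Rightarrow> f m"
    let ?q = "Prec pa (Comp p [Proj 0])"
    have q: "computes ?q [n] (?g n)" for n
      by (rule computes_Prec[where f = ?g]) (auto intro: pa f computes_rules)
    have "(UNIV :: nat set) = insert 0 (range Suc)"
      using not0_implies_Suc by blast
    then have "range ?g = ?g ` insert 0 (range Suc)" by simp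
    then have "insert a A = range ?g"
      unfolding A image_insert image_image by simp
    then have "insert a A = {y. \<exists>n. computes ?q [n] y}"
      using q by (auto dest: computes_det)
    with q show ?thesis unfolding recursively_enumerable_def by blast
  qed
qed

lemma recursively_enumerable_finite_Un:
  assumes "finite F" "recursively_enumerable A"
  shows "recursively_enumerable (F \<union> A)"
  using assms(1) by induction (simp_all add: assms(2) recursively_enumerable_insert)

section \<open>Rewriting with relators\<close>

text \<open>The empty word makes the set nonempty, so that it is the range of an enumeration.\<close>

definition insertable :: "'g set \<Rightarrow> 'g word set \<Rightarrow> 'g word set" where
  "insertable X R = insert [] ((\<lambda>x. [x, inv_letter x]) ` letters X) \<union> R"

inductive rewrite_step :: "'g set \<Rightarrow> 'g word set \<Rightarrow> 'g word \<Rightarrow> 'g word \<Rightarrow> bool" for X R where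
  insertion: "s \<in> insertable X R \<Longrightarrow> rewrite_step X R (a @ b) (a @ s @ b)"
| deletion: "s \<in> insertable X R \<Longrightarrow> rewrite_step X R (a @ s @ b) (a @ b)"

abbreviation rewrite_equiv :: "'g set \<Rightarrow> 'g word set \<Rightarrow> 'g word \<Rightarrow> 'g word \<Rightarrow> bool" where
  "rewrite_equiv X R \<equiv> (rewrite_step X R)\<^sup>*\<^sup>*"

section \<open>Rewriting equivalence as a congruence on words\<close>

lemma rewrite_equiv_sym: "rewrite_equiv X R u v \<Longrightarrow> rewrite_equiv X R v u"
proof (induction rule: rtranclp_induct)
  case (step v w)
  from step(2) have "rewrite_step X R w v" by cases (auto intro: rewrite_step.intros)
  from this step(3) show ?case by (rule converse_rtranclp_into_rtranclp)
qed simp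

lemma rewrite_equiv_context:
  "rewrite_equiv X R u v \<Longrightarrow> rewrite_equiv X R (a @ u @ b) (a @ v @ b)"
proof (induction rule: rtranclp_induct)
  case (step v w)
  from step(2) have "rewrite_step X R (a @ v @ b) (a @ w @ b)"
  proof cases
    case (insertion s c d)
    then show ?thesis using rewrite_step.insertion[of s X R "a @ c" "d @ b"] by simp
  next
    case (deletion s c d)
    then show ?thesis using rewrite_step.deletion[of s X R "a @ c" "d @ b"] by simp
  qed
  with step(3) show ?case by simp
qed simp

lemma rewrite_equiv_append:
  assumes "rewrite_equiv X R u u'" "rewrite_equiv X R v v'"
  shows "rewrite_equiv X R (u @ v) (u' @ v')"
  using rewrite_equiv_context[OF assms(1), of "[]" v]
    rewrite_equiv_context[OF assms(2), of u' "[]"] by simp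

lemma rewrite_equiv_insertable: "s \<in> insertable X R \<Longrightarrow> rewrite_equiv X R s []"
  using deletion[of s X R "[]" "[]"] by auto

text \<open>Each cancellation made by \<open>cons_reduce\<close> is the deletion of some
  \<open>[x, inv_letter x]\<close> with \<open>x\<close> a letter over \<open>X\<close>.\<close>

lemma rewrite_equiv_free_reduce: "w \<in> words X \<Longrightarrow> rewrite_equiv X R w (free_reduce w)"
proof (induction w)
  case (Cons x w)
  then have x: "x \<in> letters X" and IH: "rewrite_equiv X R w (free_reduce w)"
    by (auto simp: words_def)
  have "rewrite_equiv X R (x # w) (x # free_reduce w)"
    using rewrite_equiv_context[OF IH, of "[x]" "[]"] by simp
  moreover have "rewrite_equiv X R (x # free_reduce w) (free_reduce (x # w))"
  proof (cases "\<exists>v. free_reduce w = inv_letter x # v")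
    case True
    then obtain v where v: "free_reduce w = inv_letter x # v" ..
    have "rewrite_equiv X R [x, inv_letter x] []"
      using x by (intro rewrite_equiv_insertable) (simp add: insertable_def)
    from rewrite_equiv_context[OF this, of "[]" v] v show ?thesis
      by (simp add: free_reduce_def)
  next
    case False
    then have "free_reduce (x # w) = x # free_reduce w"
      by (cases "free_reduce w") (auto simp: free_reduce_def)
    then show ?thesis by simp
  qed
  ultimately show ?case by (rule rtranclp_trans)
qed (simp add: free_reduce_def)

lemma rewrite_equiv_mult:
  assumes "u \<in> carrier (free_group X)" "v \<in> carrier (free_group X)"
  shows "rewrite_equiv X R (u \<otimes>\<^bsub>free_group X\<^esub> v) (u @ v)"
  using assms rewrite_equiv_sym[OF rewrite_equiv_free_reduce[of "u @ v" X R]]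
  by (simp add: free_group_def words_def)

text \<open>No explicit form of the inverse is used: the product in the free group is the empty
  word, and products rewrite to concatenations.\<close>

lemma rewrite_equiv_inv:
  assumes "g \<in> carrier (free_group X)"
  shows "rewrite_equiv X R (g @ inv\<^bsub>free_group X\<^esub> g) []"
    and "rewrite_equiv X R (inv\<^bsub>free_group X\<^esub> g @ g) []"
proof -
  interpret group "free_group X" by (rule group_free_group)
  have "rewrite_equiv X R (\<one>\<^bsub>free_group X\<^esub>) (g @ inv\<^bsub>free_group X\<^esub> g)"
    "rewrite_equiv X R (\<one>\<^bsub>free_group X\<^esub>) (inv\<^bsub>free_group X\<^esub> g @ g)"
    using rewrite_equiv_mult[OF assms inv_closed[OF assms], of R]
      rewrite_equiv_mult[OF inv_closed[OF assms] assms, of R] assms by simp_all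
  moreover have "\<one>\<^bsub>free_group X\<^esub> = []" by (simp add: free_group_def)
  ultimately show "rewrite_equiv X R (g @ inv\<^bsub>free_group X\<^esub> g) []"
    and "rewrite_equiv X R (inv\<^bsub>free_group X\<^esub> g @ g) []"
    by (simp_all only: rewrite_equiv_sym)
qed

text \<open>In a conjugate of a relator, the relator is deleted and the conjugating elements cancel.
  Triviality then passes to inverses and products by induction over \<open>generate\<close>.\<close>

lemma relator_subgroup_rewrite:
  assumes R: "R \<subseteq> words X" and n: "n \<in> relator_subgroup X R"
  shows "rewrite_equiv X R n []"
proof -
  interpret group "free_group X" by (rule group_free_group)
  let ?F = "free_group X"
  let ?S = "{g \<otimes>\<^bsub>?F\<^esub> s \<otimes>\<^bsub>?F\<^esub> inv\<^bsub>?F\<^esub> g | g s. g \<in> carrier ?F \<and> s \<in> free_reduce ` R}"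
  have red: "free_reduce ` R \<subseteq> carrier ?F"
    using R by (auto simp: free_group_def reduced_free_reduce free_reduce_words)
  have gens: "h \<in> carrier ?F \<and> rewrite_equiv X R h []" if "h \<in> ?S" for h
  proof -
    from that obtain g r where h: "h = g \<otimes>\<^bsub>?F\<^esub> free_reduce r \<otimes>\<^bsub>?F\<^esub> inv\<^bsub>?F\<^esub> g"
      and g: "g \<in> carrier ?F" and r: "r \<in> R" by blast
    have s: "free_reduce r \<in> carrier ?F" using red r by blast
    have "rewrite_equiv X R (free_reduce r) r"
      using r R by (blast intro: rewrite_equiv_sym[OF rewrite_equiv_free_reduce])
    also have "rewrite_equiv X R r []"
      using r by (intro rewrite_equiv_insertable) (simp add: insertable_def)
    finally have "rewrite_equiv X R (g @ free_reduce r) g"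
      using rewrite_equiv_context[of X R "free_reduce r" "[]" g "[]"] by simp
    with rewrite_equiv_mult[OF g s] have "rewrite_equiv X R (g \<otimes>\<^bsub>?F\<^esub> free_reduce r) g"
      by (rule rtranclp_trans)
    then have "rewrite_equiv X R (g \<otimes>\<^bsub>?F\<^esub> free_reduce r @ inv\<^bsub>?F\<^esub> g) (g @ inv\<^bsub>?F\<^esub> g)"
      by (rule rewrite_equiv_append) simp
    moreover have "rewrite_equiv X R h (g \<otimes>\<^bsub>?F\<^esub> free_reduce r @ inv\<^bsub>?F\<^esub> g)"
      unfolding h using g s by (intro rewrite_equiv_mult) simp_all
    ultimately have "rewrite_equiv X R h []"
      using rewrite_equiv_inv(1)[OF g] by (meson rtranclp_trans)
    with g s show ?thesis by (simp add: h)
  qed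
  from n have "n \<in> generate ?F ?S" by (simp add: relator_subgroup_def normal_closure_def)
  \<comment> \<open>Membership in the carrier is part of the induction because the rules for
    products and inverses require it.\<close>
  then have "n \<in> carrier ?F \<and> rewrite_equiv X R n []"
  proof induction
    case one
    then show ?case by (simp add: free_group_def words_def)
  next
    case (incl h)
    then show ?case by (rule gens)
  next
    case (inv h)
    from gens[OF inv] have h: "h \<in> carrier ?F" "rewrite_equiv X R h []" by auto
    \<comment> \<open>Since \<open>h\<close> rewrites to the empty word, it may be inserted after
      its inverse, and the two then cancel.\<close>
    from h(2) have "rewrite_equiv X R (inv\<^bsub>?F\<^esub> h @ []) (inv\<^bsub>?F\<^esub> h @ h)"
      by (intro rewrite_equiv_append rewrite_equiv_sym[of X R h]) auto
    with rewrite_equiv_inv(2)[OF h(1), of R] h(1) show ?case by (auto intro: rtranclp_trans)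
  next
    case (eng h1 h2)
    then have "rewrite_equiv X R (h1 @ h2) ([] @ [])"
      by (intro rewrite_equiv_append) auto
    with eng rewrite_equiv_mult[of h1 X h2 R] show ?case by (auto intro: rtranclp_trans)
  qed
  then show ?thesis ..
qed

text \<open>Equal cosets give \<open>free_reduce u\<close> as a product of some \<open>n\<close> in
  the relator subgroup with \<open>free_reduce v\<close>, and \<open>n\<close> rewrites to the empty
  word.\<close>

lemma rewrite_equiv_if_element_of_eq:
  assumes R: "R \<subseteq> words X" and uv: "u \<in> words X" "v \<in> words X"
    and eq: "element_of X R u = element_of X R v"
  shows "rewrite_equiv X R u v"
proof -
  interpret N: normal "relator_subgroup X R" "free_group X"
    using R by (rule relator_subgroup_normal)
  have c: "free_reduce w \<in> carrier (free_group X)" if "w \<in> words X" for w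
    using that by (simp add: free_group_def reduced_free_reduce free_reduce_words)
  have "free_reduce u \<in> relator_subgroup X R #>\<^bsub>free_group X\<^esub> free_reduce v"
    using N.rcos_self[OF c[OF uv(1)] N.is_subgroup] eq by (simp add: element_of_def)
  then obtain n where n: "n \<in> relator_subgroup X R"
    and u: "free_reduce u = n \<otimes>\<^bsub>free_group X\<^esub> free_reduce v"
    by (auto simp: r_coset_def)
  have "rewrite_equiv X R u (free_reduce u)" by (rule rewrite_equiv_free_reduce[OF uv(1)])
  also have "rewrite_equiv X R (free_reduce u) (n @ free_reduce v)"
    unfolding u using n uv(2) by (intro rewrite_equiv_mult c) auto
  also have "rewrite_equiv X R (n @ free_reduce v) ([] @ v)"
    by (intro rewrite_equiv_append relator_subgroup_rewrite[OF R n]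
        rewrite_equiv_sym[OF rewrite_equiv_free_reduce[OF uv(2)]])
  finally show ?thesis by simp
qed

section \<open>Coded rewriting: soundness and completeness\<close>

lemma words_append: "u @ v \<in> words X \<longleftrightarrow> u \<in> words X \<and> v \<in> words X"
  by (simp add: words_def)

lemma insertable_words: "R \<subseteq> words X \<Longrightarrow> insertable X R \<subseteq> words X"
  by (auto simp: insertable_def words_def)

lemma element_of_insert:
  assumes R: "R \<subseteq> words X" and ab: "a \<in> words X" "b \<in> words X" and s: "s \<in> insertable X R"
  shows "element_of X R (a @ s @ b) = element_of X R (a @ b)"
proof -
  interpret N: normal "relator_subgroup X R" "free_group X"
    using R by (rule relator_subgroup_normal)
  interpret G: group "presented_group X R" using R by (rule group_presented_group)
  have "free_reduce [] = \<one>\<^bsub>free_group X\<^esub>" by (simp add: free_reduce_def free_group_def)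
  then have one: "element_of X R [] = \<one>\<^bsub>presented_group X R\<^esub>"
    by (simp add: element_of_def presented_group_def FactGroup_def N.coset_mult_one[OF N.subset])
  have s': "s \<in> words X" using s insertable_words[OF R] by blast
  have "element_of X R s = element_of X R []"
  proof (cases "s \<in> R")
    case True
    have "free_reduce s \<in> carrier (free_group X)"
      using s' by (simp add: free_group_def reduced_free_reduce free_reduce_words)
    \<comment> \<open>The generators of the normal closure are conjugates; a relator is one of them
      as its conjugate by the identity.\<close>
    moreover from this
    have "\<one>\<^bsub>free_group X\<^esub> \<otimes>\<^bsub>free_group X\<^esub> free_reduce s \<otimes>\<^bsub>free_group X\<^esub> inv\<^bsub>free_group X\<^esub> \<one>\<^bsub>free_group X\<^esub>
      = free_reduce s" by simp
    ultimately have "free_reduce s \<in> relator_subgroup X R"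
      unfolding relator_subgroup_def normal_closure_def using True
      by (intro generate.incl) (metis (mono_tags, lifting) N.one_closed image_eqI mem_Collect_eq)
    then have "element_of X R s = relator_subgroup X R"
      unfolding element_of_def by (rule N.rcos_const[OF group_free_group])
    with one show ?thesis by (simp add: presented_group_def FactGroup_def)
  next
    case False
    with s have "free_reduce s = []" by (auto simp: insertable_def free_reduce_def)
    then show ?thesis by (simp add: element_of_def free_reduce_def)
  qed
  with one ab s' R show ?thesis
    by (simp add: element_of_append words_append element_of_in_carrier)
qed

text \<open>The decoded \<open>a\<close> and \<open>b\<close> are arbitrary number lists, but a
  match with \<open>map \<nu> u\<close> forces them to be images of segments of
  \<open>u\<close>.\<close>

lemma rewrite_at_sound:
  assumes R: "R \<subseteq> words X" and \<nu>: "inj_on \<nu> (letters X)"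
    and r: "range r = map \<nu> ` insertable X R" and u: "u \<in> words X"
  shows "\<exists>v \<in> words X. rewrite_at r i (map \<nu> u) = map \<nu> v \<and> element_of X R v = element_of X R u"
proof -
  define a where "a = list_decode (fst (prod_decode i))"
  define k where "k = fst (prod_decode (snd (prod_decode i)))"
  define b where "b = list_decode (snd (prod_decode (snd (prod_decode i))))"
  obtain s where s: "s \<in> insertable X R" "r k = map \<nu> s" using r by blast
  have sX: "s \<in> words X" using s insertable_words[OF R] by blast
  have rw: "rewrite_at r i (map \<nu> u) = (if map \<nu> u = a @ b then a @ map \<nu> s @ b
      else if map \<nu> u = a @ map \<nu> s @ b then a @ b else map \<nu> u)"
    by (simp add: rewrite_at_def a_def b_def s(2)[unfolded k_def])
  consider "map \<nu> u = a @ b" | "map \<nu> u \<noteq> a @ b" "map \<nu> u = a @ map \<nu> s @ b"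
    | "map \<nu> u \<noteq> a @ b" "map \<nu> u \<noteq> a @ map \<nu> s @ b" by blast
  then show ?thesis
  proof cases
    case 1
    then obtain a' b' where ab: "u = a' @ b'" "a = map \<nu> a'" "b = map \<nu> b'"
      by (auto simp: map_eq_append_conv)
    with u have "a' \<in> words X" "b' \<in> words X" by (simp_all add: words_append)
    moreover have "rewrite_at r i (map \<nu> u) = map \<nu> (a' @ s @ b')"
      unfolding rw using 1 ab(2,3) by simp
    ultimately show ?thesis
      using ab(1) sX s(1) R
      by (intro bexI[of _ "a' @ s @ b'"]) (simp_all add: words_append element_of_insert)
  next
    case 2
    from 2(2) obtain a' t where a': "u = a' @ t" "a = map \<nu> a'" "map \<nu> s @ b = map \<nu> t"
      by (auto simp: map_eq_append_conv)
    from a'(3) obtain s' b' where "t = s' @ b'" "b = map \<nu> b'" "map \<nu> s = map \<nu> s'"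
      by (auto simp: append_eq_map_conv)
    with a' have ab: "u = a' @ s' @ b'" "a = map \<nu> a'" "b = map \<nu> b'" "map \<nu> s = map \<nu> s'"
      by simp_all
    with u have X: "a' \<in> words X" "b' \<in> words X" "s' \<in> words X" by (simp_all add: words_append)
    \<comment> \<open>The matched segment \<open>s'\<close> agrees with \<open>s\<close> only in its
      numbering; injectivity of \<open>\<nu>\<close> on letters makes it the same word.\<close>
    have "s = s'"
      using ab(4) \<nu> sX X(3) by (intro map_inj_on[of \<nu> s s']) (auto simp: words_def intro: inj_on_subset)
    moreover have "rewrite_at r i (map \<nu> u) = map \<nu> (a' @ b')"
      unfolding rw using 2 ab(2,3) by simp
    ultimately show ?thesis
      using ab(1) X s(1) R
      by (intro bexI[of _ "a' @ b'"]) (simp_all add: words_append element_of_insert)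
  next
    case 3
    with u show ?thesis by (intro bexI[of _ u]) (simp_all add: rw)
  qed
qed

lemma rewrite_seq_sound:
  assumes "R \<subseteq> words X" "inj_on \<nu> (letters X)" "range r = map \<nu> ` insertable X R"
    and "u \<in> words X"
  shows "\<exists>v \<in> words X. rewrite_seq r c (map \<nu> u) = map \<nu> v \<and> element_of X R v = element_of X R u"
proof -
  have "\<exists>v \<in> words X. foldl (\<lambda>u i. rewrite_at r i u) (map \<nu> u) is = map \<nu> v \<and>
    element_of X R v = element_of X R u" for "is"
    using assms(4)
  proof (induction "is" arbitrary: u)
    case (Cons i "is")
    from rewrite_at_sound[OF assms(1-3) Cons.prems, of i] obtain u' where
      u': "u' \<in> words X" "rewrite_at r i (map \<nu> u) = map \<nu> u'"
        "element_of X R u' = element_of X R u" by blast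
    from Cons.IH[OF u'(1)] u' show ?case by simp
  qed auto
  then show ?thesis by (simp add: rewrite_seq_def)
qed

lemma rewrite_seq_complete:
  assumes r: "range r = map \<nu> ` insertable X R" and "rewrite_equiv X R u v"
  shows "\<exists>c. rewrite_seq r c (map \<nu> u) = map \<nu> v"
  using assms(2)
proof (induction rule: rtranclp_induct)
  case base
  have "rewrite_seq r (list_encode []) (map \<nu> u) = map \<nu> u" unfolding rewrite_seq_def by simp
  then show ?case ..
next
  case (step v w)
  from step(2) obtain i where i: "rewrite_at r i (map \<nu> v) = map \<nu> w"
  proof cases
    case (insertion s a b)
    then obtain k where "r k = map \<nu> s" using r by (metis imageI rangeE)
    with insertion that[of "prod_encode (list_encode (map \<nu> a), prod_encode (k, list_encode (map \<nu> b)))"]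
    show ?thesis by (simp add: rewrite_at_def Let_def)
  next
    case (deletion s a b)
    then obtain k where "r k = map \<nu> s" using r by (metis imageI rangeE)
    \<comment> \<open>\<open>rewrite_at\<close> tests for insertion first. On
      \<open>a @ s @ b\<close> that test succeeds only for empty \<open>s\<close>, where insertion
      and deletion give the same result.\<close>
    with deletion that[of "prod_encode (list_encode (map \<nu> a), prod_encode (k, list_encode (map \<nu> b)))"]
    show ?thesis by (simp add: rewrite_at_def Let_def)
  qed
  from step.IH obtain c where c: "rewrite_seq r c (map \<nu> u) = map \<nu> v" ..
  have "rewrite_seq r (list_encode (list_decode c @ [i])) (map \<nu> u) = map \<nu> w"
    using c i by (simp add: rewrite_seq_def)
  then show ?case ..
qed

section \<open>Recognizing geodesics\<close>

lemma geodesic_iff_rep: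
  assumes "u \<in> words X"
  shows "geodesic X R u \<longleftrightarrow> geodesic_rep X R u u"
proof -
  obtain v where v: "geodesic_rep X R u v" using ex_geodesic_rep[OF assms] by blast
  with assms show ?thesis
    by (auto simp: geodesic_def geodesic_length_eq geodesic_rep_def intro: le_antisym)
qed

lemma geodesic_length_le:
  assumes "u \<in> words X"
  shows "geodesic_length X R u \<le> length u"
  using ex_geodesic_rep[OF assms, of R] assms
  by (auto simp: geodesic_length_eq geodesic_rep_def)

lemma geodesic_Nil: "geodesic X R []"
  using geodesic_length_le[of "[]" X R] by (simp add: geodesic_def words_def)

text \<open>A shorter representative of the prefix, followed by \<open>v\<close>, would be a shorter
  representative of the whole word.\<close>

lemma geodesic_prefix:
  assumes R: "R \<subseteq> words X" and g: "geodesic X R (u @ v)"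
  shows "geodesic X R u"
proof -
  from g have uv: "u \<in> words X" "v \<in> words X" "u @ v \<in> words X"
    by (auto simp: geodesic_def words_append)
  have "length u \<le> length w" if w: "w \<in> words X" "element_of X R w = element_of X R u" for w
  proof -
    have "element_of X R (w @ v) = element_of X R (u @ v)"
      using R uv w by (simp add: element_of_append)
    moreover have "w @ v \<in> words X" using w uv by (simp add: words_append)
    ultimately have "length (u @ v) \<le> length (w @ v)"
      using g uv(3) unfolding geodesic_iff_rep[OF uv(3)] geodesic_rep_def by blast
    then show ?thesis by simp
  qed
  with uv show ?thesis by (simp add: geodesic_iff_rep geodesic_rep_def)
qed

text \<open>The geodesic length of \<open>u @ [x]\<close> is at most \<open>length u + 1\<close>, so
  exceeding \<open>length u\<close> means attaining this bound. This turns the given decision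
  procedure into a test for geodesic extensions.\<close>

lemma geodesic_snoc_iff:
  assumes "geodesic X R u" "x \<in> letters X"
  shows "geodesic X R (u @ [x]) \<longleftrightarrow> geodesic_length X R (u @ [x]) > geodesic_length X R u"
proof -
  have "u @ [x] \<in> words X" using assms by (simp add: geodesic_def words_def)
  with geodesic_length_le[OF this, of R] assms(1) show ?thesis
    by (auto simp: geodesic_def)
qed

section \<open>Greedy recognition of geodesics\<close>

definition greedy :: "'g set \<Rightarrow> 'g word set \<Rightarrow> 'g word \<Rightarrow> 'g word" where
  "greedy X R v = foldl (\<lambda>u x. if geodesic X R (u @ [x]) then u @ [x] else u) [] v"

lemma greedy_snoc:
  "greedy X R (v @ [x]) =
    (if geodesic X R (greedy X R v @ [x]) then greedy X R v @ [x] else greedy X R v)"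
  by (simp add: greedy_def)

lemma geodesic_greedy: "geodesic X R (greedy X R v)"
  by (induction v rule: rev_induct) (simp_all add: greedy_snoc, simp add: greedy_def geodesic_Nil)

text \<open>Greedy output is always geodesic. Conversely, all prefixes of a geodesic are geodesic,
  so none of its letters is dropped.\<close>

lemma greedy_eq_iff:
  assumes "R \<subseteq> words X"
  shows "greedy X R v = v \<longleftrightarrow> geodesic X R v"
proof
  show "geodesic X R v" if "greedy X R v = v"
    using geodesic_greedy[of X R v] that by simp
  show "greedy X R v = v" if "geodesic X R v"
    using that
  proof (induction v rule: rev_induct)
    case (snoc x v)
    with geodesic_prefix[OF assms snoc.prems] show ?case by (simp add: greedy_snoc)
  qed (simp add: greedy_def)
qed

definition "greedy_prog p =
  fold_prog (Comp if_prog [Comp p [Proj 1, Proj 0],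
    Comp append_prog [Proj 1, Comp cons_prog [Proj 0, Zero]], Proj 1])"

lemma computes_greedy:
  assumes p: "decides_length_increase \<nu> X R p" and v: "v \<in> words X"
  shows "computes (Comp (greedy_prog p) [Proj 0, Zero]) [word_code \<nu> v] (word_code \<nu> (greedy X R v))"
proof -
  let ?f = "\<lambda>i. word_code \<nu> (greedy X R (take i v))"
  have "computes (greedy_prog p) [list_encode (map \<nu> v), ?f 0] (?f (length (map \<nu> v)))"
    unfolding greedy_prog_def
  proof (rule computes_fold)
    fix i assume "i < length (map \<nu> v)"
    then have i: "i < length v" by simp
    define u x where "u = greedy X R (take i v)" and "x = v ! i"
    have x: "x \<in> letters X" using v i by (auto simp: words_def x_def)
    \<comment> \<open>This is why the run halts on every word: \<open>p\<close> is only ever queried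
      at a geodesic accumulator.\<close>
    have g: "geodesic X R u" by (simp add: u_def geodesic_greedy)
    let ?b = "if geodesic X R (u @ [x]) then 1 else 0 :: nat"
    let ?xs = "[\<nu> x, word_code \<nu> u]"
    have "computes p [word_code \<nu> u, \<nu> x] ?b"
      using p g x unfolding decides_length_increase_def geodesic_snoc_iff[OF g x] by blast
    then have b: "computes (Comp p [Proj 1, Proj 0]) ?xs ?b"
      by (blast intro: computes_rules)
    have "computes (Comp cons_prog [Proj 0, Zero]) ?xs (list_encode [\<nu> x])"
      using computes_cons[of "\<nu> x" "[]"] by (auto intro: computes_rules)
    then have "computes (Comp append_prog [Proj 1, Comp cons_prog [Proj 0, Zero]]) ?xs
      (list_encode (map \<nu> u @ [\<nu> x]))"
      unfolding word_code_def by (blast intro: computes_rules computes_append)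
    then have "computes (Comp if_prog [Comp p [Proj 1, Proj 0],
      Comp append_prog [Proj 1, Comp cons_prog [Proj 0, Zero]], Proj 1]) ?xs
      (if ?b = 0 then word_code \<nu> u else list_encode (map \<nu> u @ [\<nu> x]))"
      by (rule computes_Comp(3)[OF b _ computes_Proj(2) computes_if])
    moreover have "?f (Suc i) = (if ?b = 0 then word_code \<nu> u else list_encode (map \<nu> u @ [\<nu> x]))"
      using i by (simp add: take_Suc_conv_app_nth greedy_snoc word_code_def flip: u_def x_def)
    ultimately show "computes (Comp if_prog [Comp p [Proj 1, Proj 0],
      Comp append_prog [Proj 1, Comp cons_prog [Proj 0, Zero]], Proj 1]) [map \<nu> v ! i, ?f i] (?f (Suc i))"
      using i by (simp only: nth_map u_def x_def)
  qed
  then have "computes (greedy_prog p) [word_code \<nu> v, 0] (word_code \<nu> (greedy X R v))"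
    by (simp add: word_code_def greedy_def)
  \<comment> \<open>The argument \<open>Zero\<close> supplies the code of the empty word, the
    initial accumulator.\<close>
  then show ?thesis by (auto intro: computes_rules)
qed

lemma word_code_inj:
  assumes "inj_on \<nu> (letters X)" "u \<in> words X" "v \<in> words X" "word_code \<nu> u = word_code \<nu> v"
  shows "u = v"
proof (rule map_inj_on)
  show "map \<nu> u = map \<nu> v" using assms(4) by (simp add: word_code_def list_encode_eq)
  show "inj_on \<nu> (set u \<union> set v)"
    using assms(1-3) by (auto simp: words_def intro: inj_on_subset)
qed

theorem proposition3:
  fixes X :: "'g set" and R :: "'g word set" and \<nu> :: "'g letter \<Rightarrow> nat"
  assumes "finite X"
    and "R \<subseteq> words X"
    and "inj_on \<nu> (letters X)"
    and "recursively_enumerable (word_code \<nu> ` R)"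
    and "\<exists>p. decides_length_increase \<nu> X R p"
  shows "\<exists>q. finds_geodesic_rep \<nu> X R q"
proof -
  obtain p where p: "decides_length_increase \<nu> X R p" using assms(5) ..
  have "finite (letters X)" using assms(1) by (simp add: letters_def)
  then have "recursively_enumerable
    (word_code \<nu> ` insert [] ((\<lambda>x. [x, inv_letter x]) ` letters X) \<union> word_code \<nu> ` R)"
    using assms(4) by (intro recursively_enumerable_finite_Un) simp_all
  then have "recursively_enumerable (word_code \<nu> ` insertable X R)"
    unfolding insertable_def image_Un .
  then obtain e where e: "\<forall>n. \<exists>y. computes e [n] y"
    "word_code \<nu> ` insertable X R = {y. \<exists>n. computes e [n] y}"
    unfolding recursively_enumerable_def by (auto simp: insertable_def)
  from e(1) obtain f where f: "\<And>n. computes e [n] (f n)" by metis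
  define r where "r n = list_decode (f n)" for n
  have e': "computes e [n] (list_encode (r n))" for n using f by (simp add: r_def)
  have "range f = word_code \<nu> ` insertable X R"
    unfolding e(2) using f by (auto dest: computes_det)
  then have "range r = list_decode ` word_code \<nu> ` insertable X R"
    unfolding r_def by (metis image_image)
  then have r: "range r = map \<nu> ` insertable X R"
    by (simp add: image_image word_code_def)
  let ?rw = "fold_prog (rewrite_prog e)"
  \<comment> \<open>On input \<open>c\<close> and the code of \<open>w\<close>, the test compares
    the rewritten word with its greedy version; 0 signals a geodesic.\<close>
  let ?test = "Comp neq_prog [?rw, Comp (Comp (greedy_prog p) [Proj 0, Zero]) [?rw]]"
  have "finds_geodesic_rep \<nu> X R (Comp ?rw [Mu ?test, Proj 0])"
    unfolding finds_geodesic_rep_def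
  proof
    fix w assume w: "w \<in> words X"
    have "\<forall>c. \<exists>v. v \<in> words X \<and> rewrite_seq r c (map \<nu> w) = map \<nu> v \<and> element_of X R v = element_of X R w"
      using rewrite_seq_sound[OF assms(2,3) r w] by blast
    \<comment> \<open>\<open>V c\<close> is the word reached from \<open>w\<close> by the derivation
      coded by \<open>c\<close>; it always represents the same element as \<open>w\<close>.\<close>
    then obtain V where V: "\<And>c. V c \<in> words X" "\<And>c. rewrite_seq r c (map \<nu> w) = map \<nu> (V c)"
      "\<And>c. element_of X R (V c) = element_of X R w" by metis
    have rw: "computes ?rw [c, word_code \<nu> w] (word_code \<nu> (V c))" for c
      using computes_rewrite_seq[of e r c "map \<nu> w", OF e'] by (simp add: V(2) word_code_def)
    define t where "t c = (word_code \<nu> (V c) - word_code \<nu> (greedy X R (V c)))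
      + (word_code \<nu> (greedy X R (V c)) - word_code \<nu> (V c))" for c
    have test: "computes ?test [c, word_code \<nu> w] (t c)" for c
      unfolding t_def
      by (rule computes_Comp rw computes_greedy[OF p V(1)] computes_neq)+
    have t: "t c = 0 \<longleftrightarrow> geodesic X R (V c)" for c
    proof -
      have "greedy X R (V c) \<in> words X" using geodesic_greedy[of X R] by (simp add: geodesic_def)
      then have "t c = 0 \<longleftrightarrow> greedy X R (V c) = V c"
        using word_code_inj[OF assms(3) _ V(1)[of c]] by (auto simp: t_def)
      then show ?thesis by (simp add: greedy_eq_iff[OF assms(2)])
    qed
    obtain v where v: "geodesic_rep X R w v" using ex_geodesic_rep[OF w] by blast
    then have vX: "v \<in> words X" "element_of X R w = element_of X R v" "geodesic X R v"
      by (simp_all add: geodesic_rep_def geodesic_iff_rep)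
    \<comment> \<open>The search terminates because some derivation leads from \<open>w\<close> to
      its geodesic representative \<open>v\<close>.\<close>
    obtain c where "rewrite_seq r c (map \<nu> w) = map \<nu> v"
      using rewrite_seq_complete[OF r rewrite_equiv_if_element_of_eq[OF assms(2) w vX(1,2)]] ..
    then have "V c = v"
      by (intro word_code_inj[OF assms(3) V(1) vX(1)]) (simp add: V(2) word_code_def)
    with vX(3) have c: "t c = 0" by (simp add: t)
    \<comment> \<open>The search may stop at a geodesic other than \<open>v\<close>; any geodesic
      \<open>V m\<close> serves, since it represents the element of \<open>w\<close>.\<close>
    define m where "m = (LEAST c. t c = 0)"
    have "computes (Mu ?test) [word_code \<nu> w] m"
      unfolding m_def by (rule computes_Mu[OF test c])
    then have "computes (Comp ?rw [Mu ?test, Proj 0]) [word_code \<nu> w] (word_code \<nu> (V m))"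
      by (rule computes_Comp(2)[OF _ computes_Proj(1) rw])
    moreover have "geodesic X R (V m)"
      using LeastI[of "\<lambda>c. t c = 0", OF c] by (simp add: m_def t)
    then have "geodesic_rep X R w (V m)"
      by (simp add: geodesic_iff_rep[OF V(1)] geodesic_rep_def V(3))
    ultimately show "\<exists>v. geodesic_rep X R w v \<and>
      computes (Comp ?rw [Mu ?test, Proj 0]) [word_code \<nu> w] (word_code \<nu> v)" by blast
  qed
  then show ?thesis ..
qed

end
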